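(* (i) For every $n$ there exist directed graphs on $\Theta(n)$ vertices with positive real edge capacities and designated source $s$ and sink $t$ that have $\Omega(n^2)$ vital edges. (ii) For every directed graph $G$ on $n$ vertices with positive real edge capacities, a designated source vertex $s$ and a designated sink vertex $t$, the number of loose edges of $G$ is at most $n-2$.
   Context: An $(s,t)$-cut is a set $C\subset V$ with $s\in C$, $t\notin C$; its capacity is the sum of capacities of edges from $C$ to $V\setminus C$. An edge is vital if its removal strictly decreases the minimum capacity of an $(s,t)$-cut. A vital edge $e$ is tight if some maximum $(s,t)$-flow $f$ satisfies $f(e)=w(e)$, where $w(e)$ is the capacity of $e$; a vital edge that is not tight is loose. *)

theory Defs
  imports
    Complex_Main
    "HOL-Library.Landau_Symbols"
    "Graph_Theory.Digraph"
begin

text \<open>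
  Antiparallel arcs and arcs entering the source or leaving the sink are allowed.
  Loops and parallel arcs are allowed too; where a simple digraph is meant, the predicate
  \<^const>\<open>digraph\<close> is required in addition.
\<close>

locale flow_network = fin_digraph G
  for G :: "('a, 'b) pre_digraph" (structure) +
  fixes w :: "'b \<Rightarrow> real" and s t :: 'a
  assumes source_in_verts: "s \<in> verts G"
    and sink_in_verts: "t \<in> verts G"
    and source_neq_sink: "s \<noteq> t"
    and capacity_pos: "e \<in> arcs G \<Longrightarrow> 0 < w e"

definition st_cut :: "('a, 'b) pre_digraph \<Rightarrow> 'a \<Rightarrow> 'a \<Rightarrow> 'a set \<Rightarrow> bool" where
  "st_cut G s t C \<longleftrightarrow> C \<subseteq> verts G \<and> s \<in> C \<and> t \<notin> C"

definition cut_capacity :: "('a, 'b) pre_digraph \<Rightarrow> ('b \<Rightarrow> real) \<Rightarrow> 'a set \<Rightarrow> real" where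
  "cut_capacity G w C = (\<Sum>e \<in> {e \<in> arcs G. tail G e \<in> C \<and> head G e \<in> verts G - C}. w e)"

text \<open>In a flow network the minimum below is taken over a finite nonempty set.\<close>

definition min_cut_capacity ::
    "('a, 'b) pre_digraph \<Rightarrow> ('b \<Rightarrow> real) \<Rightarrow> 'a \<Rightarrow> 'a \<Rightarrow> real" where
  "min_cut_capacity G w s t = Min {cut_capacity G w C |C. st_cut G s t C}"

definition vital ::
    "('a, 'b) pre_digraph \<Rightarrow> ('b \<Rightarrow> real) \<Rightarrow> 'a \<Rightarrow> 'a \<Rightarrow> 'b \<Rightarrow> bool" where
  "vital G w s t e \<longleftrightarrow>
     e \<in> arcs G \<and> min_cut_capacity (pre_digraph.del_arc G e) w s t < min_cut_capacity G w s t"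

definition st_flow ::
    "('a, 'b) pre_digraph \<Rightarrow> ('b \<Rightarrow> real) \<Rightarrow> 'a \<Rightarrow> 'a \<Rightarrow> ('b \<Rightarrow> real) \<Rightarrow> bool" where
  "st_flow G w s t f \<longleftrightarrow>
     (\<forall>e \<in> arcs G. 0 \<le> f e \<and> f e \<le> w e) \<and>
     (\<forall>v \<in> verts G - {s, t}. sum f (in_arcs G v) = sum f (out_arcs G v))"

definition flow_value :: "('a, 'b) pre_digraph \<Rightarrow> 'a \<Rightarrow> ('b \<Rightarrow> real) \<Rightarrow> real" where
  "flow_value G s f = sum f (out_arcs G s) - sum f (in_arcs G s)"

definition max_st_flow ::
    "('a, 'b) pre_digraph \<Rightarrow> ('b \<Rightarrow> real) \<Rightarrow> 'a \<Rightarrow> 'a \<Rightarrow> ('b \<Rightarrow> real) \<Rightarrow> bool" where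
  "max_st_flow G w s t f \<longleftrightarrow>
     st_flow G w s t f \<and> (\<forall>g. st_flow G w s t g \<longrightarrow> flow_value G s g \<le> flow_value G s f)"

definition tight ::
    "('a, 'b) pre_digraph \<Rightarrow> ('b \<Rightarrow> real) \<Rightarrow> 'a \<Rightarrow> 'a \<Rightarrow> 'b \<Rightarrow> bool" where
  "tight G w s t e \<longleftrightarrow> vital G w s t e \<and> (\<exists>f. max_st_flow G w s t f \<and> f e = w e)"

definition loose ::
    "('a, 'b) pre_digraph \<Rightarrow> ('b \<Rightarrow> real) \<Rightarrow> 'a \<Rightarrow> 'a \<Rightarrow> 'b \<Rightarrow> bool" where
  "loose G w s t e \<longleftrightarrow> vital G w s t e \<and> \<not> tight G w s t e"

end

theory Submission
  imports Defs "HOL-Analysis.Function_Topology"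
begin

text \<open>
  For (i), orient all pairs of \<open>{0..n+1}\<close> upwards and choose capacities that form a flow.
  Nothing enters an initial segment, so every initial segment is a minimum cut, and every arc
  leaves one.

  For (ii), a loose arc is neither empty nor saturated in any maximum flow. Take a maximum flow
  with as few such arcs as possible. If there were more than \<open>n - 2\<close> of them, the \<open>n - 2\<close>
  conservation equations would have a nonzero solution supported on them; adding multiples of
  either sign keeps a flow, so by maximality the value does not change, and moving until some
  arc becomes empty or saturated contradicts the choice of the flow.
\<close>

section \<open>Linear algebra: homogeneous systems with more unknowns than equations\<close>

lemma homogeneous_system_nontrivial_solution:
  fixes a :: "'v \<Rightarrow> 'e \<Rightarrow> 'k :: field"
  assumes "finite V" "finite F" "card V < card F"
  shows "\<exists>g. (\<exists>e\<in>F. g e \<noteq> 0) \<and> (\<forall>e. e \<notin> F \<longrightarrow> g e = 0) \<and> (\<forall>v\<in>V. (\<Sum>e\<in>F. a v e * g e) = 0)"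
  using assms
proof (induction V arbitrary: F a rule: finite_induct)
  case empty
  then obtain e where "e \<in> F" by (metis card_gt_0_iff card.empty ex_in_conv)
  then show ?case by (intro exI[of _ "\<lambda>x. if x \<in> F then 1 else 0"]) auto
next
  case (insert v V)
  show ?case
  proof (cases "\<forall>e\<in>F. a v e = 0")
    case True
    from insert.IH[of F a] insert.prems insert.hyps obtain g where
      "\<exists>e\<in>F. g e \<noteq> 0" "\<forall>e. e \<notin> F \<longrightarrow> g e = 0" "\<forall>u\<in>V. (\<Sum>e\<in>F. a u e * g e) = 0"
      by auto
    with True show ?thesis by (intro exI[of _ g]) auto
  next
    case False
    then obtain p where p: "p \<in> F" "a v p \<noteq> 0" by blast
    \<comment> \<open>Row \<open>u\<close> minus the multiple of row \<open>v\<close> that clears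
      column \<open>p\<close>.\<close>
    define b where "b u e = a u e - a u p * a v e / a v p" for u e
    have "card V < card (F - {p})" "finite (F - {p})" using insert p by auto
    from insert.IH[OF this(2,1), of b] obtain g where g:
      "\<exists>e\<in>F - {p}. g e \<noteq> 0" "\<And>e. e \<notin> F - {p} \<Longrightarrow> g e = 0"
      "\<And>u. u \<in> V \<Longrightarrow> (\<Sum>e\<in>F - {p}. b u e * g e) = 0" by blast
    \<comment> \<open>Back substitution: the value of unknown \<open>p\<close> forced by equation
      \<open>v\<close>.\<close>
    define c where "c = - (\<Sum>e\<in>F - {p}. a v e * g e) / a v p"
    define g' where "g' = g(p := c)"
    have sum_g': "(\<Sum>e\<in>F. a u e * g' e) = a u p * c + (\<Sum>e\<in>F - {p}. a u e * g e)" for u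
      using p insert.prems by (subst sum.remove[of F p]) (auto simp: g'_def intro!: sum.cong)
    have "(\<Sum>e\<in>F. a v e * g' e) = 0"
      unfolding sum_g' using p by (simp add: c_def)
    moreover have "(\<Sum>e\<in>F. a u e * g' e) = 0" if "u \<in> V" for u
    proof -
      have "(\<Sum>e\<in>F - {p}. b u e * g e)
          = (\<Sum>e\<in>F - {p}. a u e * g e - (a u p / a v p) * (a v e * g e))"
        by (intro sum.cong) (auto simp: b_def algebra_simps)
      also have "\<dots> = (\<Sum>e\<in>F - {p}. a u e * g e) - (a u p / a v p) * (\<Sum>e\<in>F - {p}. a v e * g e)"
        by (simp add: sum_subtractf sum_distrib_left)
      also have "\<dots> = (\<Sum>e\<in>F. a u e * g' e)"
        unfolding sum_g' by (simp add: c_def)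
      finally show ?thesis using g(3)[OF that] by simp
    qed
    moreover have "\<exists>e\<in>F. g' e \<noteq> 0" "\<forall>e. e \<notin> F \<longrightarrow> g' e = 0"
      using g(1,2) p by (auto simp: g'_def)
    ultimately show ?thesis by blast
  qed
qed

section \<open>Net outflow of vertices and of vertex sets\<close>

text \<open>At an arbitrary vertex \<^term>\<open>v\<close>, \<^term>\<open>flow_value G v f\<close> is the net outflow of \<^term>\<open>f\<close>.\<close>

lemma flow_value_linear_combination:
  "flow_value G v (\<lambda>e. a * f e + b * g e) = a * flow_value G v f + b * flow_value G v g"
  by (simp add: flow_value_def sum.distrib sum_distrib_left algebra_simps)

lemma (in fin_digraph) flow_value_single_arc:
  assumes "e \<in> arcs G"
  shows "flow_value G v (\<lambda>x. of_bool (x = e)) = of_bool (v = tail G e) - of_bool (v = head G e)"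
  using assms by (auto simp: flow_value_def of_bool_def sum.delta finite_in_arcs finite_out_arcs)

text \<open>An arc with both ends in \<open>C\<close> (the set \<open>?B\<close>, loops included) is
  counted once as outgoing and once as incoming, so it cancels.\<close>

lemma (in fin_digraph) sum_flow_value:
  assumes C: "C \<subseteq> verts G"
  shows "(\<Sum>v\<in>C. flow_value G v f) =
    sum f {e \<in> arcs G. tail G e \<in> C \<and> head G e \<in> verts G - C} -
    sum f {e \<in> arcs G. tail G e \<in> verts G - C \<and> head G e \<in> C}"
    (is "_ = sum f ?O - sum f ?I")
proof -
  have fin: "finite C" using C finite_verts by (rule finite_subset)
  let ?B = "{e \<in> arcs G. tail G e \<in> C \<and> head G e \<in> C}"
  have "(\<Sum>v\<in>C. sum f (out_arcs G v)) = sum f (\<Union>v\<in>C. out_arcs G v)"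
    by (rule sum.UNION_disjoint[symmetric]) (use fin in auto)
  also have "(\<Union>v\<in>C. out_arcs G v) = ?O \<union> ?B" using C by auto
  also have "sum f (?O \<union> ?B) = sum f ?O + sum f ?B" by (rule sum.union_disjoint) auto
  finally have 1: "(\<Sum>v\<in>C. sum f (out_arcs G v)) = sum f ?O + sum f ?B" .
  have "(\<Sum>v\<in>C. sum f (in_arcs G v)) = sum f (\<Union>v\<in>C. in_arcs G v)"
    by (rule sum.UNION_disjoint[symmetric]) (use fin in auto)
  also have "(\<Union>v\<in>C. in_arcs G v) = ?I \<union> ?B" using C by auto
  also have "sum f (?I \<union> ?B) = sum f ?I + sum f ?B" by (rule sum.union_disjoint) auto
  finally show ?thesis using 1 by (simp add: flow_value_def sum_subtractf)
qed

lemma st_flow_iff: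
  "st_flow G w s t f \<longleftrightarrow>
     (\<forall>e \<in> arcs G. 0 \<le> f e \<and> f e \<le> w e) \<and> (\<forall>v \<in> verts G - {s, t}. flow_value G v f = 0)"
  unfolding st_flow_def flow_value_def right_minus_eq by metis

section \<open>Weak duality between flows and cuts, and deletion of an arc\<close>

context flow_network
begin

lemma flow_value_eq_net_outflow_of_cut:
  assumes "st_flow G w s t f" "st_cut G s t C"
  shows "flow_value G s f =
    sum f {e \<in> arcs G. tail G e \<in> C \<and> head G e \<in> verts G - C} -
    sum f {e \<in> arcs G. tail G e \<in> verts G - C \<and> head G e \<in> C}"
proof -
  have C: "C \<subseteq> verts G" "finite C" "s \<in> C" "t \<notin> C"
    using assms finite_subset[OF _ finite_verts] by (auto simp: st_cut_def)
  \<comment> \<open>As \<open>t\<close> lies outside \<open>C\<close>, conservation annihilates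
    every term except that of \<open>s\<close>.\<close>
  have "(\<Sum>v\<in>C. flow_value G v f) = (\<Sum>v\<in>{s}. flow_value G v f)"
    by (rule sum.mono_neutral_right) (use C assms in \<open>auto simp: st_flow_iff\<close>)
  with sum_flow_value[OF C(1), of f] show ?thesis by simp
qed

lemma flow_value_le_cut_capacity:
  assumes f: "st_flow G w s t f" and C: "st_cut G s t C"
  shows "flow_value G s f \<le> cut_capacity G w C"
proof -
  have "0 \<le> sum f {e \<in> arcs G. tail G e \<in> verts G - C \<and> head G e \<in> C}"
    by (rule sum_nonneg) (use f in \<open>auto simp: st_flow_iff\<close>)
  moreover have "sum f {e \<in> arcs G. tail G e \<in> C \<and> head G e \<in> verts G - C} \<le> cut_capacity G w C"
    unfolding cut_capacity_def by (rule sum_mono) (use f in \<open>auto simp: st_flow_iff\<close>)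
  ultimately show ?thesis using flow_value_eq_net_outflow_of_cut[OF f C] by linarith
qed

lemma finite_cut_capacities: "finite {cut_capacity G w C |C. st_cut G s t C}"
proof -
  have "{cut_capacity G w C |C. st_cut G s t C} \<subseteq> cut_capacity G w ` Pow (verts G)"
    by (auto simp: st_cut_def)
  then show ?thesis by (rule finite_subset) auto
qed

lemma min_cut_capacity_le: "st_cut G s t C \<Longrightarrow> min_cut_capacity G w s t \<le> cut_capacity G w C"
  unfolding min_cut_capacity_def by (rule Min_le) (use finite_cut_capacities in auto)

lemma flow_value_le_min_cut_capacity:
  assumes "st_flow G w s t f"
  shows "flow_value G s f \<le> min_cut_capacity G w s t"
proof -
  have "st_cut G s t {s}" using source_in_verts source_neq_sink by (auto simp: st_cut_def)
  then show ?thesis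
    unfolding min_cut_capacity_def using assms flow_value_le_cut_capacity finite_cut_capacities
    by (subst Min_ge_iff) auto
qed

lemma flow_network_del_arc: "flow_network (del_arc e) w s t"
proof -
  interpret D: fin_digraph "del_arc e" by (rule fin_digraph_del_arc)
  show ?thesis
    by unfold_locales (use source_in_verts sink_in_verts source_neq_sink capacity_pos in auto)
qed

lemma cut_capacity_del_arc:
  assumes "e \<in> arcs G" "tail G e \<in> C" "head G e \<in> verts G - C"
  shows "cut_capacity G w C = w e + cut_capacity (del_arc e) w C"
proof -
  have "{x \<in> arcs (del_arc e). tail (del_arc e) x \<in> C \<and> head (del_arc e) x \<in> verts (del_arc e) - C} =
    {x \<in> arcs G. tail G x \<in> C \<and> head G x \<in> verts G - C} - {e}" by auto
  then show ?thesis
    unfolding cut_capacity_def using assms by (subst sum.remove[of _ e]) auto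
qed

text \<open>The flow \<open>f\<close> certifies that \<open>C\<close> is a minimum cut, and deleting
  \<open>e\<close> lowers the capacity of \<open>C\<close> by \<open>w e > 0\<close>. This is the
  criterion for vitality used in (i).\<close>

lemma vital_if_crosses_min_cut:
  assumes f: "st_flow G w s t f" and C: "st_cut G s t C" and le: "cut_capacity G w C \<le> flow_value G s f"
    and e: "e \<in> arcs G" "tail G e \<in> C" "head G e \<in> verts G - C"
  shows "vital G w s t e"
proof -
  interpret D: flow_network "del_arc e" w s t by (rule flow_network_del_arc)
  have "min_cut_capacity (del_arc e) w s t \<le> cut_capacity (del_arc e) w C"
    by (rule D.min_cut_capacity_le) (use C in \<open>auto simp: st_cut_def\<close>)
  also have "\<dots> < cut_capacity G w C" using cut_capacity_del_arc[OF e] capacity_pos[OF e(1)] by simp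
  finally show ?thesis
    unfolding vital_def using le flow_value_le_min_cut_capacity[OF f] e by auto
qed

section \<open>Existence of a maximum flow by compactness\<close>

lemma max_st_flow_exists: "\<exists>f. max_st_flow G w s t f"
proof -
  \<comment> \<open>A flow is unconstrained outside \<open>arcs G\<close>; pinning those coordinates
    to 0 makes the box a product of compact sets.\<close>
  define K where "K = (PiE UNIV (\<lambda>e. if e \<in> arcs G then {0..w e} else {0}) :: ('b \<Rightarrow> real) set)"
  define S where "S = K \<inter> {f. \<forall>v \<in> verts G - {s, t}. flow_value G v f = 0}"
  have "compactin (product_topology (\<lambda>i. euclidean) UNIV) K"
    unfolding K_def compactin_PiE by auto
  then have "compact K" by (simp add: euclidean_product_topology)
  have cont: "continuous_on A (flow_value G v)" for A v
    unfolding flow_value_def [abs_def]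
    by (intro continuous_intros continuous_on_subset[OF continuous_on_product_coordinates]) auto
  have "{f. \<forall>v \<in> verts G - {s, t}. flow_value G v f = 0} =
    (\<Inter>v\<in>verts G - {s, t}. {f. flow_value G v f = 0})" by auto
  also have "closed \<dots>"
    by (intro closed_INT ballI closed_Collect_eq cont continuous_on_const)
  finally have "compact S" unfolding S_def using \<open>compact K\<close> by (rule compact_Int_closed[rotated])
  moreover have "(\<lambda>_. 0) \<in> S"
    using capacity_pos by (auto simp: S_def K_def flow_value_def less_imp_le)
  ultimately obtain f where f: "f \<in> S" "\<And>g. g \<in> S \<Longrightarrow> flow_value G s g \<le> flow_value G s f"
    using continuous_attains_sup[of S "flow_value G s"] cont by blast
  have "st_flow G w s t f" using f(1) by (auto simp: st_flow_iff S_def K_def PiE_iff split: if_splits)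
  moreover have "flow_value G s g \<le> flow_value G s f" if "st_flow G w s t g" for g
  proof -
    \<comment> \<open>An arbitrary flow is brought into \<open>S\<close> by zeroing it off the arcs,
      which changes no net outflow.\<close>
    define h where "h = (\<lambda>e. if e \<in> arcs G then g e else 0)"
    have h: "flow_value G v h = flow_value G v g" for v
      unfolding flow_value_def h_def
      by (intro arg_cong2[where f="(-)"] sum.cong) auto
    have "h \<in> S" using that by (auto simp: S_def K_def h st_flow_iff) (auto simp: h_def)
    from f(2)[OF this] show ?thesis by (simp add: h)
  qed
  ultimately show ?thesis unfolding max_st_flow_def by blast
qed

section \<open>Residual reachability and the max-flow min-cut theorem\<close>

text \<open>Reachability in the residual graph, encoded without paths: \<delta> extra units can be
  shipped from \<open>u\<close> to \<open>v\<close> within the capacities. Only the net outflows of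
  \<open>h\<close> are compared with those of \<open>f\<close>.\<close>

definition residual :: "('b \<Rightarrow> real) \<Rightarrow> 'a \<Rightarrow> 'a \<Rightarrow> bool" where
  "residual f u v \<longleftrightarrow> (\<exists>h \<delta>. 0 < \<delta> \<and> (\<forall>e \<in> arcs G. 0 \<le> h e \<and> h e \<le> w e) \<and>
     (\<forall>x. flow_value G x h = flow_value G x f + \<delta> * (of_bool (x = u) - of_bool (x = v))))"

text \<open>A convex combination in which the amounts sent along both legs agree.\<close>

lemma residual_trans:
  assumes "residual f u v" "residual f v z"
  shows "residual f u z"
proof -
  from assms(1) obtain h \<delta> where h: "0 < \<delta>" "\<And>e. e \<in> arcs G \<Longrightarrow> 0 \<le> h e \<and> h e \<le> w e"
     "\<And>x. flow_value G x h = flow_value G x f + \<delta> * (of_bool (x = u) - of_bool (x = v))"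
    unfolding residual_def by blast
  from assms(2) obtain k \<eta> where k: "0 < \<eta>" "\<And>e. e \<in> arcs G \<Longrightarrow> 0 \<le> k e \<and> k e \<le> w e"
     "\<And>x. flow_value G x k = flow_value G x f + \<eta> * (of_bool (x = v) - of_bool (x = z))"
    unfolding residual_def by blast
  define a b where "a = \<eta> / (\<delta> + \<eta>)" and "b = \<delta> / (\<delta> + \<eta>)"
  have ab: "0 < a" "0 < b" "a + b = 1" "b * \<eta> = a * \<delta>"
    using h(1) k(1) by (auto simp: a_def b_def add_divide_distrib[symmetric])
  have "0 \<le> a * h e + b * k e \<and> a * h e + b * k e \<le> w e" if "e \<in> arcs G" for e
    using h(2)[OF that] k(2)[OF that] ab convex_bound_le[of "h e" "w e" "k e" a b] by auto
  moreover have "flow_value G x (\<lambda>e. a * h e + b * k e) =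
     flow_value G x f + (a * \<delta>) * (of_bool (x = u) - of_bool (x = z))" for x
  proof -
    have "flow_value G x (\<lambda>e. a * h e + b * k e) =
      (a + b) * flow_value G x f + (a * \<delta>) * (of_bool (x = u) - of_bool (x = v))
        + (b * \<eta>) * (of_bool (x = v) - of_bool (x = z))"
      unfolding flow_value_linear_combination h(3) k(3) by (simp add: algebra_simps)
    then show ?thesis unfolding ab(3,4) by (simp add: algebra_simps)
  qed
  moreover have "0 < a * \<delta>" using ab h by simp
  ultimately show ?thesis unfolding residual_def
    by (intro exI[of _ "\<lambda>e. a * h e + b * k e"] exI[of _ "a * \<delta>"]) blast
qed

text \<open>Either the spare capacity of \<open>e\<close> is filled completely, or all flow on
  \<open>e\<close> is cancelled; \<delta> is the amount changed.\<close>

lemma residual_arc: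
  assumes f: "st_flow G w s t f" and e: "e \<in> arcs G"
  shows "f e < w e \<Longrightarrow> residual f (tail G e) (head G e)"
    and "0 < f e \<Longrightarrow> residual f (head G e) (tail G e)"
proof -
  have f_bounds: "0 \<le> f x \<and> f x \<le> w x" if "x \<in> arcs G" for x
    using f that by (auto simp: st_flow_iff)
  \<comment> \<open>The factor 1 gives the term the shape that
    \<open>flow_value_linear_combination\<close> rewrites.\<close>
  have val: "flow_value G x (\<lambda>y. 1 * f y + c * of_bool (y = e)) =
      flow_value G x f + c * (of_bool (x = tail G e) - of_bool (x = head G e))" for x c
    unfolding flow_value_linear_combination flow_value_single_arc[OF e] by simp
  show "residual f (tail G e) (head G e)" if "f e < w e"
    unfolding residual_def
    by (rule exI[of _ "\<lambda>y. 1 * f y + (w e - f e) * of_bool (y = e)"], rule exI[of _ "w e - f e"])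
       (use that f_bounds capacity_pos[OF e] in \<open>auto simp only: val\<close>, auto simp: of_bool_def less_imp_le)
  show "residual f (head G e) (tail G e)" if "0 < f e"
    unfolding residual_def
    by (rule exI[of _ "\<lambda>y. 1 * f y + (- f e) * of_bool (y = e)"], rule exI[of _ "f e"])
       (use that f_bounds capacity_pos[OF e] in \<open>auto simp only: val\<close>, auto simp: of_bool_def less_imp_le algebra_simps)
qed

text \<open>The cut consists of the vertices residually reachable from \<open>s\<close>. Maximality
  keeps \<open>t\<close> out. By \<open>residual_arc\<close> and transitivity, an unsaturated
  leaving arc or a nonempty entering arc would extend the set, so the net outflow of the cut is its
  full capacity.\<close>

lemma max_flow_min_cut:
  assumes f: "max_st_flow G w s t f"
  shows "flow_value G s f = min_cut_capacity G w s t"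
proof -
  have flow: "st_flow G w s t f" using f by (simp add: max_st_flow_def)
  define C where "C = insert s {v \<in> verts G. residual f s v}"
  have "\<not> residual f s t"
  proof
    assume "residual f s t"
    then obtain h \<delta> where h: "0 < \<delta>" "\<forall>e \<in> arcs G. 0 \<le> h e \<and> h e \<le> w e"
      "\<And>x. flow_value G x h = flow_value G x f + \<delta> * (of_bool (x = s) - of_bool (x = t))"
      unfolding residual_def by blast
    then have "st_flow G w s t h" using flow by (auto simp: st_flow_iff)
    then have "flow_value G s h \<le> flow_value G s f" using f by (simp add: max_st_flow_def)
    with h source_neq_sink show False by simp
  qed
  then have cut: "st_cut G s t C"
    using source_in_verts source_neq_sink by (auto simp: st_cut_def C_def)
  have step: "v \<in> C" if "u \<in> C" "residual f u v" "v \<in> verts G" for u v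
    using that residual_trans by (auto simp: C_def)
  have "f e = w e" if "e \<in> arcs G" "tail G e \<in> C" "head G e \<in> verts G - C" for e
    using residual_arc(1)[OF flow that(1)] step[OF that(2), of "head G e"] that flow
    by (force simp: st_flow_iff)
  then have "sum f {e \<in> arcs G. tail G e \<in> C \<and> head G e \<in> verts G - C} = cut_capacity G w C"
    unfolding cut_capacity_def by (intro sum.cong) auto
  moreover have "f e = 0" if "e \<in> arcs G" "tail G e \<in> verts G - C" "head G e \<in> C" for e
    using residual_arc(2)[OF flow that(1)] step[OF that(3), of "tail G e"] that flow
    by (force simp: st_flow_iff)
  then have "sum f {e \<in> arcs G. tail G e \<in> verts G - C \<and> head G e \<in> C} = 0"
    by (intro sum.neutral) auto
  ultimately have "flow_value G s f = cut_capacity G w C"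
    using flow_value_eq_net_outflow_of_cut[OF flow cut] by simp
  with min_cut_capacity_le[OF cut] flow_value_le_min_cut_capacity[OF flow] show ?thesis by linarith
qed

section \<open>Loose arcs and the upper bound\<close>

text \<open>Saturation would make the arc tight. If \<open>f e = 0\<close>, then \<open>f\<close>
  remains a flow of the same value after deleting \<open>e\<close>, so the minimum cut does not drop
  and \<open>e\<close> is not vital.\<close>

lemma loose_imp_fractional:
  assumes e: "loose G w s t e" and f: "max_st_flow G w s t f"
  shows "e \<in> arcs G \<and> 0 < f e \<and> f e < w e"
proof -
  have flow: "st_flow G w s t f" using f by (simp add: max_st_flow_def)
  have vit: "vital G w s t e" "f e \<noteq> w e" using e f by (auto simp: loose_def tight_def)
  then have arc: "e \<in> arcs G" by (simp add: vital_def)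
  have "f e \<noteq> 0"
  proof
    assume 0: "f e = 0"
    interpret D: flow_network "del_arc e" w s t by (rule flow_network_del_arc)
    have val: "flow_value (del_arc e) v f = flow_value G v f" for v
      unfolding flow_value_def in_arcs_del_arc_iff out_arcs_del_arc_iff
      using 0 by (auto simp: sum_diff1 finite_in_arcs finite_out_arcs)
    have "st_flow (del_arc e) w s t f" using flow by (auto simp: st_flow_iff val)
    then have "flow_value G s f \<le> min_cut_capacity (del_arc e) w s t"
      using D.flow_value_le_min_cut_capacity[of f] val by simp
    with max_flow_min_cut[OF f] vit show False by (simp add: vital_def)
  qed
  with vit arc flow show ?thesis by (fastforce simp: st_flow_iff)
qed

definition fractional :: "('b \<Rightarrow> real) \<Rightarrow> 'b set" where
  "fractional f = {e \<in> arcs G. 0 < f e \<and> f e < w e}"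

text \<open>Move along \<open>g\<close> until the first arc of its support reaches a bound; that arc
  stops being fractional, and arcs outside the support keep their flow. The value is recorded
  exactly so that \<open>g\<close> and its negative can be compared.\<close>

lemma push_flow:
  assumes f: "st_flow G w s t f" and nz: "\<exists>e\<in>fractional f. g e \<noteq> 0"
    and supp: "\<And>e. e \<notin> fractional f \<Longrightarrow> g e = 0"
    and cons: "\<And>v. v \<in> verts G - {s, t} \<Longrightarrow> flow_value G v g = 0"
  shows "\<exists>f' \<delta>. 0 < \<delta> \<and> st_flow G w s t f' \<and> fractional f' \<subset> fractional f \<and>
    flow_value G s f' = flow_value G s f + \<delta> * flow_value G s g"
proof -
  define F where "F = {e \<in> fractional f. g e \<noteq> 0}"
  \<comment> \<open>The largest step arc \<open>e\<close> allows: up to \<open>w e\<close> if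
    \<open>g\<close> raises its flow, down to 0 if \<open>g\<close> lowers it.\<close>
  define room where "room e = (if 0 < g e then (w e - f e) / g e else f e / - g e)" for e
  define \<delta> where "\<delta> = Min (room ` F)"
  have F: "finite F" "F \<noteq> {}" using nz by (auto simp: F_def fractional_def)
  have room_pos: "0 < room e" if "e \<in> F" for e
    using that by (auto simp: room_def F_def fractional_def divide_pos_pos divide_pos_neg)
  have \<delta>: "0 < \<delta>" unfolding \<delta>_def using F room_pos by (subst Min_gr_iff) auto
  have \<delta>_le: "\<delta> \<le> room e" if "e \<in> F" for e unfolding \<delta>_def using that F by simp
  \<comment> \<open>A bottleneck arc, which is exactly empty or saturated after a step of length
    \<delta>.\<close>
  obtain p where p: "p \<in> F" "\<delta> = room p"
    using Min_in[of "room ` F"] F unfolding \<delta>_def by blast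
  define f' where "f' = (\<lambda>e. 1 * f e + \<delta> * g e)"
  have val: "flow_value G v f' = flow_value G v f + \<delta> * flow_value G v g" for v
    unfolding f'_def flow_value_linear_combination by simp
  have same: "f' e = f e" if "e \<notin> F" for e
    using that supp[of e] by (auto simp: f'_def F_def)
  have bounds: "0 \<le> f' e \<and> f' e \<le> w e" if "e \<in> arcs G" for e
  proof (cases "e \<in> F")
    case False
    then show ?thesis using same[OF False] f that by (auto simp: st_flow_iff)
  next
    case True
    then have fe: "0 < f e" "f e < w e" "g e \<noteq> 0" by (auto simp: F_def fractional_def)
    show ?thesis
    proof (cases "0 < g e")
      case pos: True
      then have "\<delta> * g e \<le> w e - f e" using \<delta>_le[OF True] by (simp add: room_def field_simps)
      moreover have "0 \<le> \<delta> * g e" using pos \<delta> by simp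
      ultimately show ?thesis using fe by (simp add: f'_def)
    next
      case False
      then have neg: "g e < 0" using fe by simp
      then have "\<delta> * (- g e) \<le> f e" using \<delta>_le[OF True] False by (simp add: room_def field_simps)
      moreover have "\<delta> * g e \<le> 0" using neg \<delta> by (simp add: mult_le_0_iff)
      ultimately show ?thesis using fe by (simp add: f'_def)
    qed
  qed
  have "st_flow G w s t f'" using bounds f cons by (auto simp: st_flow_iff val)
  moreover have "fractional f' \<subseteq> fractional f"
  proof
    fix e assume "e \<in> fractional f'"
    then show "e \<in> fractional f"
      using same[of e] by (cases "e \<in> F") (auto simp: fractional_def F_def)
  qed
  moreover have "p \<notin> fractional f'"
    using p by (auto simp: fractional_def f'_def room_def F_def split: if_splits)
  moreover have "p \<in> fractional f" using p by (simp add: F_def)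
  ultimately show ?thesis using \<delta> val by blast
qed

lemma card_loose_le: "card {e. loose G w s t e} \<le> card (verts G) - 2"
proof -
  obtain f where f: "max_st_flow G w s t f"
    and least: "\<And>g. max_st_flow G w s t g \<Longrightarrow> card (fractional f) \<le> card (fractional g)"
    using max_st_flow_exists ex_has_least_nat[of "max_st_flow G w s t" _ "card \<circ> fractional"]
    by auto
  have flow: "st_flow G w s t f" using f by (simp add: max_st_flow_def)
  let ?F = "fractional f"
  have fin: "finite ?F" by (simp add: fractional_def)
  have "card ?F \<le> card (verts G - {s, t})"
  proof (rule ccontr)
    assume "\<not> ?thesis"
    then have "card (verts G - {s, t}) < card ?F" by simp
    \<comment> \<open>The matrix is the incidence matrix: column \<open>e\<close> holds the net
      outflows of a unit of flow on \<open>e\<close>.\<close>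
    from homogeneous_system_nontrivial_solution[OF _ fin this,
        of "\<lambda>v e. flow_value G v (\<lambda>x. of_bool (x = e))"]
    obtain g where g: "\<exists>e\<in>?F. g e \<noteq> 0" "\<And>e. e \<notin> ?F \<Longrightarrow> g e = 0"
      "\<And>v. v \<in> verts G - {s, t} \<Longrightarrow> (\<Sum>e\<in>?F. flow_value G v (\<lambda>x. of_bool (x = e)) * g e) = 0"
      by auto
    have "flow_value G v g = (\<Sum>e\<in>?F. flow_value G v (\<lambda>x. of_bool (x = e)) * g e)" for v
    proof -
      have *: "sum g A = (\<Sum>e\<in>?F. of_bool (e \<in> A) * g e)" if "finite A" for A
      proof -
        have "sum g A = sum g (?F \<inter> A)" by (rule sum.mono_neutral_right) (use that g(2) in auto)
        then show ?thesis using fin by (auto simp: sum.inter_restrict intro!: sum.cong)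
      qed
      have "flow_value G v g = (\<Sum>e\<in>?F. (of_bool (e \<in> out_arcs G v) - of_bool (e \<in> in_arcs G v)) * g e)"
        unfolding flow_value_def
        by (subst (1 2) *) (auto simp: finite_in_arcs finite_out_arcs sum_subtractf algebra_simps)
      also have "\<dots> = (\<Sum>e\<in>?F. flow_value G v (\<lambda>x. of_bool (x = e)) * g e)"
        by (rule sum.cong) (auto simp: flow_value_single_arc fractional_def)
      finally show ?thesis .
    qed
    with g(3) have cons: "\<And>v. v \<in> verts G - {s, t} \<Longrightarrow> flow_value G v g = 0" by simp
    from push_flow[OF flow g(1,2) cons] obtain f1 d1 where f1: "0 < d1" "st_flow G w s t f1"
      "fractional f1 \<subset> ?F" "flow_value G s f1 = flow_value G s f + d1 * flow_value G s g" by blast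
    \<comment> \<open>The opposite direction only serves to bound the value of \<open>g\<close> from
      below; the smaller fractional set comes from \<open>f1\<close>.\<close>
    have neg: "flow_value G v (\<lambda>e. - g e) = - flow_value G v g" for v
      by (simp add: flow_value_def sum_negf)
    from push_flow[OF flow, of "\<lambda>e. - g e"] g(1,2) cons obtain f2 d2 where f2: "0 < d2"
      "st_flow G w s t f2" "flow_value G s f2 = flow_value G s f - d2 * flow_value G s g"
      by (auto simp: neg)
    have "d1 * flow_value G s g \<le> 0" "0 \<le> d2 * flow_value G s g"
      using f f1 f2 unfolding max_st_flow_def by fastforce+
    then have "flow_value G s g = 0" using f1(1) f2(1)
      by (simp add: mult_le_0_iff zero_le_mult_iff)
    then have "max_st_flow G w s t f1" using f f1 by (simp add: max_st_flow_def)
    from least[OF this] psubset_card_mono[OF fin f1(3)] show False by simp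
  qed
  \<comment> \<open>Since \<open>s\<close> and \<open>t\<close> are distinct vertices, the
    natural-number subtraction is not truncated.\<close>
  moreover have "card (verts G - {s, t}) = card (verts G) - 2"
    using source_in_verts sink_in_verts source_neq_sink by (simp add: card_Diff_subset)
  \<comment> \<open>The loose arcs lie in the finite set \<open>?F\<close>, so \<open>card\<close>
    is a genuine count, not the default 0 of infinite sets.\<close>
  moreover have "card {e. loose G w s t e} \<le> card ?F"
    by (rule card_mono[OF fin]) (use loose_imp_fractional f in \<open>auto simp: fractional_def\<close>)
  ultimately show ?thesis by linarith
qed

end

section \<open>The transitive tournament and its quadratically many vital arcs\<close>

definition transitive_tournament :: "nat \<Rightarrow> (nat, nat \<times> nat) pre_digraph" where
  "transitive_tournament n = \<lparr>verts = {..n+1}, arcs = {(i, j). i < j \<and> j \<le> n+1}, tail = fst, head = snd\<rparr>"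

text \<open>The capacities are chosen so that they form a flow themselves.\<close>

definition tournament_capacity :: "nat \<Rightarrow> nat \<times> nat \<Rightarrow> real" where
  "tournament_capacity n = (\<lambda>(i, j).
     if i = 0 then (if j = n+1 then 1 else real (n+1) - real j) else if j = n+1 then real i else 1)"

text \<open>Groups the arcs by head, so that counting them becomes a sum over heads.\<close>

lemma tournament_arcs_eq: "{(i, j). i < j \<and> j \<le> m} = (SIGMA j:{..m}. {..<j})\<inverse>" for m :: nat
  by auto

lemma finite_tournament_arcs: "finite {(i, j). i < j \<and> j \<le> m}" for m :: nat
  by (rule finite_subset[of _ "{..m} \<times> {..m}"]) auto

lemma card_tournament_arcs: "card {(i, j). i < j \<and> j \<le> m} = (\<Sum>j\<le>m. j)" for m :: nat
  unfolding tournament_arcs_eq by simp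

lemma digraph_transitive_tournament: "digraph (transitive_tournament n)"
  by unfold_locales
     (auto simp: transitive_tournament_def arc_to_ends_def finite_tournament_arcs)

lemma flow_network_transitive_tournament:
  "flow_network (transitive_tournament n) (tournament_capacity n) 0 (n+1)"
proof -
  interpret digraph "transitive_tournament n" by (rule digraph_transitive_tournament)
  show ?thesis
    by unfold_locales (auto simp: transitive_tournament_def tournament_capacity_def)
qed

text \<open>An inner vertex \<open>v\<close> receives \<open>n+1-v\<close> from the source and
  \<open>v-1\<close> over unit arcs; it sends \<open>v\<close> to the sink and \<open>n-v\<close>
  over unit arcs. Both totals are \<open>n\<close>.\<close>

lemma st_flow_tournament_capacity:
  "st_flow (transitive_tournament n) (tournament_capacity n) 0 (n+1) (tournament_capacity n)"
proof -
  let ?G = "transitive_tournament n" and ?w = "tournament_capacity n"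
  have "sum ?w (in_arcs ?G v) = sum ?w (out_arcs ?G v)" if v: "0 < v" "v < n+1" for v
  proof -
    have "in_arcs ?G v = (\<lambda>i. (i, v)) ` {..<v}"
      using v by (auto simp: in_arcs_def transitive_tournament_def)
    then have "sum ?w (in_arcs ?G v) = (\<Sum>i<v. ?w (i, v))"
      by (simp add: sum.reindex inj_on_def)
    also have "\<dots> = ?w (0, v) + (\<Sum>i\<in>{..<v} - {0}. ?w (i, v))"
      by (rule sum.remove) (use v in auto)
    also have "(\<Sum>i\<in>{..<v} - {0}. ?w (i, v)) = (\<Sum>i\<in>{..<v} - {0}. 1)"
      by (rule sum.cong) (use v in \<open>auto simp: tournament_capacity_def\<close>)
    finally have 1: "sum ?w (in_arcs ?G v) = real n"
      using v by (simp add: tournament_capacity_def of_nat_diff)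
    have "out_arcs ?G v = Pair v ` {v<..n+1}"
      using v by (auto simp: out_arcs_def transitive_tournament_def)
    then have "sum ?w (out_arcs ?G v) = (\<Sum>j\<in>{v<..n+1}. ?w (v, j))"
      by (simp add: sum.reindex inj_on_def)
    also have "\<dots> = ?w (v, n+1) + (\<Sum>j\<in>{v<..n+1} - {n+1}. ?w (v, j))"
      by (rule sum.remove) (use v in auto)
    also have "(\<Sum>j\<in>{v<..n+1} - {n+1}. ?w (v, j)) = (\<Sum>j\<in>{v<..n+1} - {n+1}. 1)"
      by (rule sum.cong) (use v in \<open>auto simp: tournament_capacity_def\<close>)
    finally have 2: "sum ?w (out_arcs ?G v) = real n"
      using v by (simp add: tournament_capacity_def of_nat_diff)
    from 1 2 show ?thesis by simp
  qed
  moreover have "v \<in> {0<..<n+1}" if "v \<in> verts ?G - {0, n+1}" for v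
    using that by (auto simp: transitive_tournament_def)
  moreover have "0 \<le> ?w e" if "e \<in> arcs ?G" for e
    using flow_network.capacity_pos[OF flow_network_transitive_tournament that] by simp
  ultimately show ?thesis by (auto simp: st_flow_def)
qed

lemma vital_transitive_tournament:
  "vital (transitive_tournament n) (tournament_capacity n) 0 (n+1) e \<longleftrightarrow> e \<in> arcs (transitive_tournament n)"
proof
  let ?G = "transitive_tournament n" and ?w = "tournament_capacity n"
  interpret flow_network ?G ?w 0 "n+1" by (rule flow_network_transitive_tournament)
  assume e: "e \<in> arcs ?G"
  \<comment> \<open>The initial segment ending at the tail of \<open>e\<close>: the head of
    \<open>e\<close> is larger, so \<open>e\<close> leaves it.\<close>
  let ?C = "{..fst e}"
  have cut: "st_cut ?G 0 (n+1) ?C" using e by (auto simp: st_cut_def transitive_tournament_def)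
  have "{x \<in> arcs ?G. tail ?G x \<in> verts ?G - ?C \<and> head ?G x \<in> ?C} = {}"
    by (auto simp: transitive_tournament_def)
  with flow_value_eq_net_outflow_of_cut[OF st_flow_tournament_capacity cut]
  have "flow_value ?G 0 ?w = cut_capacity ?G ?w ?C"
    unfolding cut_capacity_def by (metis (no_types) diff_zero sum.empty)
  then show "vital ?G ?w 0 (n+1) e"
    using e by (intro vital_if_crosses_min_cut[OF st_flow_tournament_capacity cut])
      (auto simp: transitive_tournament_def)
qed (simp add: vital_def)

theorem theorem5:
  shows "(\<exists>(G :: nat \<Rightarrow> (nat, nat \<times> nat) pre_digraph) (w :: nat \<Rightarrow> nat \<times> nat \<Rightarrow> real)
            (s :: nat \<Rightarrow> nat) (t :: nat \<Rightarrow> nat).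
            (\<forall>n. digraph (G n) \<and> flow_network (G n) (w n) (s n) (t n)) \<and>
            (\<lambda>n. real (card (verts (G n)))) \<in> \<Theta>(\<lambda>n. real n) \<and>
            (\<lambda>n. real (card {e. vital (G n) (w n) (s n) (t n) e})) \<in> \<Omega>(\<lambda>n. real n ^ 2))
       \<and> (\<forall>(G :: ('a, 'b) pre_digraph) (w :: 'b \<Rightarrow> real) (s :: 'a) (t :: 'a).
            flow_network G w s t \<longrightarrow> card {e. loose G w s t e} \<le> card (verts G) - 2)"
proof (intro conjI exI allI impI)
  show "digraph (transitive_tournament n)" for n by (rule digraph_transitive_tournament)
  show "flow_network (transitive_tournament n) (tournament_capacity n) 0 (n+1)" for n
    by (rule flow_network_transitive_tournament)
  show "(\<lambda>n. real (card (verts (transitive_tournament n)))) \<in> \<Theta>(\<lambda>n. real n)"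
  proof (rule bigthetaI)
    \<comment> \<open>There are \<open>n+2\<close> vertices, and \<open>n+2 \<le> 3*n\<close> from
      \<open>n = 1\<close> on.\<close>
    show "(\<lambda>n. real (card (verts (transitive_tournament n)))) \<in> O(\<lambda>n. real n)"
      by (rule landau_o.bigI[of 3])
         (auto simp: transitive_tournament_def eventually_sequentially intro!: exI[of _ 1])
    show "(\<lambda>n. real (card (verts (transitive_tournament n)))) \<in> \<Omega>(\<lambda>n. real n)"
      by (rule landau_omega.bigI[of 1]) (auto simp: transitive_tournament_def)
  qed
  show "(\<lambda>n. real (card {e. vital (transitive_tournament n) (tournament_capacity n) 0 (n+1) e}))
      \<in> \<Omega>(\<lambda>n. real n ^ 2)"
  \<comment> \<open>The number of arcs is \<open>(n+1)*(n+2)/2\<close>, hence the constant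
    1/2.\<close>
  proof (rule landau_omega.bigI[of "1/2"])
    have "real n ^ 2 / 2 \<le> real (card {e. vital (transitive_tournament n) (tournament_capacity n) 0 (n+1) e})"
      for n
    proof -
      have "card {e. vital (transitive_tournament n) (tournament_capacity n) 0 (n+1) e} = (\<Sum>j\<le>n+1. j)"
        unfolding vital_transitive_tournament
        by (simp only: Collect_mem_eq) (simp only: transitive_tournament_def pre_digraph.simps card_tournament_arcs)
      moreover have "2 * (\<Sum>j\<le>n+1. real j) = (real n + 1) * (real n + 2)"
        by (induction n) (auto simp: algebra_simps)
      ultimately show ?thesis by (simp add: power2_eq_square algebra_simps)
    qed
    then show "\<forall>\<^sub>F n in at_top. norm (real (card {e. vital (transitive_tournament n) (tournament_capacity n) 0 (n+1) e}))
      \<ge> 1/2 * norm (real n ^ 2)"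
      by (auto simp: eventually_sequentially)
  qed simp
  show "card {e. loose G w s t e} \<le> card (verts G) - 2" if "flow_network G w s t"
    for G :: "('a, 'b) pre_digraph" and w s t
    using that by (rule flow_network.card_loose_le)
qed

end
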